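(* Let $n,p\ge 1$, let $A, A_1,\dots,A_p\in\mathbb{R}^{n\times n}$, and let $\gamma_{ti}$ ($t\ge 0$, $1\le i\le p$) be scalar random variables, i.i.d. across time $t$ and mutually independent across $i$, with $\mathbb{E}[\gamma_{ti}]=0$ and $\mathbb{E}[\gamma_{ti}^2]=\alpha_i>0$. Suppose the stochastic system $$x_{t+1}=\Big(A+\sum_{i=1}^p\gamma_{ti}A_i\Big)x_t$$ is mean-square stable. Fix a symmetric matrix $Q\succeq I$ and let $P\succ 0$ be the solution of $$P=pQ+A^{\top}PA+\sum_{i=1}^p\alpha_iA_i^{\top}PA_i .$$ Let $\eta_1,\dots,\eta_p>0$ be scalars satisfying $$pQ+\sum_{i=1}^p\alpha_iA_i^{\top}PA_i\succeq\sum_{i=1}^p\eta_i\big(A_i^{\top}PA+A^{\top}PA_i\big)^{+}+\sum_{i=1}^p\sum_{j=1}^p\eta_i\eta_j\big(A_i^{\top}PA_j+A_j^{\top}PA_i\big)^{+}.$$ Then the deterministic system $$x_{t+1}=\Big(A+\sum_{i=1}^p\mu_iA_i\Big)x_t$$ is stable for all real $\mu_1,\dots,\mu_p$ with $0\le\mu_i<\eta_i$ for every $i$.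
   Context: All matrices are real. $\succeq,\succ$ denote the Loewner (positive semidefinite / positive definite) order on symmetric matrices. Positive part: a symmetric matrix $S$ with orthonormal eigenvectors $v_k$ and eigenvalues $\lambda_k$ has positive semidefinite part $S^{+}=\sum_{k:\lambda_k>0}\lambda_kv_kv_k^{\top}$. Mean-square stability: a stochastic linear system with state $x_t$ is mean-square stable if $\lim_{t\to\infty}\mathbb{E}[x_tx_t^{\top}]=0$ for every (finite) initial state $x_0$. A deterministic system $x_{t+1}=Mx_t$ is stable if the spectral radius $\rho(M)<1$. *)

theory Defs
  imports "HOL-Probability.Probability"
begin

definition symmetric :: "real^'n^'n \<Rightarrow> bool" where
  "symmetric S \<longleftrightarrow> transpose S = S"

definition psd :: "real^'n^'n \<Rightarrow> bool" where
  "psd S \<longleftrightarrow> symmetric S \<and> (\<forall>x. 0 \<le> x \<bullet> (S *v x))"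

definition pd :: "real^'n^'n \<Rightarrow> bool" where
  "pd S \<longleftrightarrow> symmetric S \<and> (\<forall>x. x \<noteq> 0 \<longrightarrow> 0 < x \<bullet> (S *v x))"

definition loewner_le :: "real^'n^'n \<Rightarrow> real^'n^'n \<Rightarrow> bool" (infix "\<preceq>\<^sub>L" 50) where
  "S \<preceq>\<^sub>L T \<longleftrightarrow> psd (T - S)"

definition outer :: "real^'n \<Rightarrow> real^'n \<Rightarrow> real^'n^'n" where
  "outer v w = (\<chi> i j. v $ i * w $ j)"

text \<open>Since \<open>'n\<close> indexes the family \<open>v\<close>, it is automatically a basis of \<open>real^'n\<close>.\<close>

definition orthonormal_eigensystem ::
    "real^'n^'n \<Rightarrow> ('n \<Rightarrow> real^'n) \<Rightarrow> ('n \<Rightarrow> real) \<Rightarrow> bool" where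
  "orthonormal_eigensystem S v l \<longleftrightarrow>
     (\<forall>j k. v j \<bullet> v k = (if j = k then 1 else 0)) \<and> (\<forall>k. S *v v k = l k *\<^sub>R v k)"

text \<open>The description below is proper for every symmetric \<open>S\<close>: an eigensystem exists, and the
  sum does not depend on its choice (see \<open>ex_orthonormal_eigensystem\<close> and \<open>pos_part_eq\<close>).\<close>

definition pos_part :: "real^'n^'n \<Rightarrow> real^'n^'n" where
  "pos_part S = (THE T. \<exists>v l. orthonormal_eigensystem S v l \<and>
     T = (\<Sum>k | l k > 0. l k *\<^sub>R outer (v k) (v k)))"

lemma outer_mult_vec: "outer v w *v x = (w \<bullet> x) *\<^sub>R v"
  by (simp add: outer_def matrix_vector_mult_def vec_eq_iff inner_vec_def sum_distrib_left
      sum_distrib_right mult_ac)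

lemma sum_mat_mult_vec: "(\<Sum>k\<in>K. f k :: real^'n^'m) *v x = (\<Sum>k\<in>K. f k *v x)"
  by (induction K rule: infinite_finite_induct) (simp_all add: matrix_vector_mult_add_rdistrib)

lemma orthonormal_eigensystem_expand:
  fixes S :: "real^'n^'n"
  assumes "orthonormal_eigensystem S v l"
  shows "x = (\<Sum>k\<in>UNIV. (v k \<bullet> x) *\<^sub>R v k)"
proof -
  have on: "v j \<bullet> v k = (if j = k then 1 else 0)" for j k
    using assms by (auto simp: orthonormal_eigensystem_def)
  have inj: "inj v"
    by (metis injI on zero_neq_one)
  have nz: "0 \<notin> range v"
    using on by (metis imageE inner_zero_left zero_neq_one)
  have "pairwise orthogonal (range v)"
    by (auto simp: pairwise_def orthogonal_def on)
  then have ind: "independent (range v)"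
    using nz pairwise_orthogonal_independent by blast
  have "card (range v) = DIM(real^'n)"
    using inj by (simp add: card_image)
  then have sp: "span (range v) = UNIV"
    using ind by (metis card_eq_dim dim_UNIV dim_eq_full finite_imageI finite_UNIV
        dim_eq_card_independent)
  let ?y = "x - (\<Sum>k\<in>UNIV. (v k \<bullet> x) *\<^sub>R v k)"
  have "orthogonal ?y z" if zr: "z \<in> range v" for z
  proof -
    obtain j where z: "z = v j" using zr by blast
    have "(\<Sum>k\<in>UNIV. (v k \<bullet> x) *\<^sub>R v k) \<bullet> v j = (\<Sum>k\<in>UNIV. if k = j then v k \<bullet> x else 0)"
      unfolding inner_sum_left by (intro sum.cong) (simp_all add: on)
    then show ?thesis by (simp add: z orthogonal_def inner_diff_left inner_commute[of x])
  qed
  then have "orthogonal ?y ?y"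
    using sp orthogonal_to_span by blast
  then show ?thesis by (simp add: orthogonal_def)
qed

lemma pos_part_sum_mult_eigenvector:
  fixes S :: "real^'n^'n"
  assumes sys: "orthonormal_eigensystem S v l" and sym: "symmetric S"
    and w: "S *v w = m *\<^sub>R w"
  shows "(\<Sum>k | l k > 0. l k *\<^sub>R outer (v k) (v k)) *v w = max m 0 *\<^sub>R w"
proof -
  have e: "(v k \<bullet> w) * l k = (v k \<bullet> w) * m" for k
  proof -
    have "l k * (v k \<bullet> w) = (S *v v k) \<bullet> w"
      using sys by (simp add: orthonormal_eigensystem_def)
    also have "\<dots> = v k \<bullet> (S *v w)"
      using sym by (metis dot_lmul_matrix symmetric_def transpose_matrix_vector)
    finally show ?thesis using w by simp
  qed
  have "(\<Sum>k | l k > 0. l k *\<^sub>R outer (v k) (v k)) *v w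
      = (\<Sum>k | l k > 0. l k *\<^sub>R (v k \<bullet> w) *\<^sub>R v k)"
    by (simp add: sum_mat_mult_vec scaleR_matrix_vector_assoc[symmetric] outer_mult_vec)
  also have "\<dots> = (\<Sum>k\<in>UNIV. if l k > 0 then l k *\<^sub>R (v k \<bullet> w) *\<^sub>R v k else 0)"
    by (simp add: sum.If_cases)
  also have "\<dots> = (\<Sum>k\<in>UNIV. max m 0 *\<^sub>R (v k \<bullet> w) *\<^sub>R v k)"
  proof (rule sum.cong)
    fix k show "(if l k > 0 then l k *\<^sub>R (v k \<bullet> w) *\<^sub>R v k else 0) = max m 0 *\<^sub>R (v k \<bullet> w) *\<^sub>R v k"
      using e[of k] by (cases "v k \<bullet> w = 0") (auto simp: max_def)
  qed simp
  also have "\<dots> = max m 0 *\<^sub>R w"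
    using orthonormal_eigensystem_expand[OF sys, of w] by (metis scaleR_right.sum)
  finally show ?thesis .
qed

lemma pos_part_eq:
  fixes S :: "real^'n^'n"
  assumes "symmetric S" "orthonormal_eigensystem S v l"
  shows "pos_part S = (\<Sum>k | l k > 0. l k *\<^sub>R outer (v k) (v k))"
  unfolding pos_part_def
proof (rule the_equality)
  fix T assume "\<exists>w m. orthonormal_eigensystem S w m \<and> T = (\<Sum>k | m k > 0. m k *\<^sub>R outer (w k) (w k))"
  then obtain w m where w: "orthonormal_eigensystem S w m"
    and T: "T = (\<Sum>k | m k > 0. m k *\<^sub>R outer (w k) (w k))" by blast
  let ?R = "\<Sum>k | l k > 0. l k *\<^sub>R outer (v k) (v k)"
  have vk: "T *v v k = ?R *v v k" for k
  proof -
    have "S *v v k = l k *\<^sub>R v k" using assms by (simp add: orthonormal_eigensystem_def)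
    show ?thesis
      unfolding T pos_part_sum_mult_eigenvector[OF w assms(1) \<open>S *v v k = l k *\<^sub>R v k\<close>]
        pos_part_sum_mult_eigenvector[OF assms(2,1) \<open>S *v v k = l k *\<^sub>R v k\<close>]
      by (rule refl)
  qed
  have "T *v x = ?R *v x" for x
  proof -
    have "T *v x = T *v (\<Sum>k\<in>UNIV. (v k \<bullet> x) *\<^sub>R v k)"
      using orthonormal_eigensystem_expand[OF assms(2), of x] by simp
    also have "\<dots> = ?R *v (\<Sum>k\<in>UNIV. (v k \<bullet> x) *\<^sub>R v k)"
      by (simp add: linear_sum[OF matrix_vector_mul_linear] matrix_vector_mult_scaleR vk)
    finally show ?thesis using orthonormal_eigensystem_expand[OF assms(2), of x] by simp
  qed
  then show "T = ?R" by (simp add: matrix_eq)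
qed (use assms in blast)

lemma symmetric_invariant_subspace_eigenbasis:
  fixes S :: "real^'n^'n"
  assumes sym: "symmetric S" and "subspace V" "\<And>x. x \<in> V \<Longrightarrow> S *v x \<in> V"
  shows "\<exists>B \<subseteq> V. pairwise orthogonal B \<and> (\<forall>b\<in>B. norm b = 1 \<and> (\<exists>l. S *v b = l *\<^sub>R b)) \<and> span B = V"
  using assms(2,3)
proof (induction "dim V" arbitrary: V rule: less_induct)
  case less
  have sa: "x \<bullet> (S *v y) = (S *v x) \<bullet> y" for x y
    using sym by (metis dot_lmul_matrix symmetric_def transpose_matrix_vector)
  show ?case
  proof (cases "V = {0}")
    case True
    then show ?thesis by (intro exI[of _ "{}"]) (auto simp: pairwise_def)
  next
    case False
    let ?K = "V \<inter> sphere 0 1"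
    obtain x0 where x0: "x0 \<in> V" "x0 \<noteq> 0"
      using False less.prems(1) subspace_0 by blast
    have "inverse (norm x0) *\<^sub>R x0 \<in> ?K"
      using x0 less.prems(1) by (auto simp: subspace_scale)
    then have ne: "?K \<noteq> {}" by blast
    have "compact ?K"
      using less.prems(1) by (intro closed_Int_compact closed_subspace) auto
    moreover have "continuous_on ?K (\<lambda>x. x \<bullet> (S *v x))"
      by (intro continuous_intros linear_continuous_on linear_conv_bounded_linear[THEN iffD1]
          matrix_vector_mul_linear)
    ultimately have "\<exists>u\<in>?K. \<forall>y\<in>?K. y \<bullet> (S *v y) \<le> u \<bullet> (S *v u)"
      using ne by (intro continuous_attains_sup)
    then obtain u where u: "u \<in> ?K" and mx: "\<And>y. y \<in> ?K \<Longrightarrow> y \<bullet> (S *v y) \<le> u \<bullet> (S *v u)"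
      by auto
    define c where "c = u \<bullet> (S *v u)"
    define g where "g = c *\<^sub>R u - S *v u"
    have uu: "u \<bullet> u = 1" using u by (simp add: norm_eq_1)
    have uV: "u \<in> V" using u by simp
    have le: "y \<bullet> (S *v y) \<le> c * (y \<bullet> y)" if "y \<in> V" for y
    proof (cases "y = 0")
      case False
      have "inverse (norm y) *\<^sub>R y \<in> ?K"
        using that False less.prems(1) by (auto simp: subspace_scale)
      from mx[OF this] have "inverse (norm y) ^ 2 * (y \<bullet> (S *v y)) \<le> c"
        by (simp add: c_def matrix_vector_mult_scaleR power2_eq_square mult_ac)
      then show ?thesis using False by (simp add: dot_square_norm field_simps)
    qed simp
    have gV: "g \<in> V"
      using less.prems uV by (simp add: g_def subspace_diff subspace_scale)
    have "0 \<le> 2 * t * (g \<bullet> g) + t^2 * (c * (g \<bullet> g) - g \<bullet> (S *v g))" for t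
    proof -
      have "u + t *\<^sub>R g \<in> V"
        using less.prems uV gV by (simp add: subspace_add subspace_scale)
      from le[OF this] have "0 \<le> c * ((u + t *\<^sub>R g) \<bullet> (u + t *\<^sub>R g)) - (u + t *\<^sub>R g) \<bullet> (S *v (u + t *\<^sub>R g))"
        by simp
      also have "\<dots> = c * (u \<bullet> u) - u \<bullet> (S *v u) + 2 * t * (c * (u \<bullet> g) - (S *v u) \<bullet> g)
           + t^2 * (c * (g \<bullet> g) - g \<bullet> (S *v g))"
        using sa[of u g]
        by (simp add: matrix_vector_right_distrib matrix_vector_mult_scaleR inner_simps
            power2_eq_square algebra_simps inner_commute)
      also have "c * (u \<bullet> u) - u \<bullet> (S *v u) = 0" by (simp add: uu c_def)
      also have "c * (u \<bullet> g) - (S *v u) \<bullet> g = g \<bullet> g"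
        by (simp add: g_def inner_diff_left inner_diff_right inner_commute right_diff_distrib)
      finally show ?thesis by simp
    qed
    note quad = this
    have "g \<bullet> g \<le> 0"
    proof (rule ccontr)
      assume "\<not> g \<bullet> g \<le> 0"
      then have gp: "g \<bullet> g > 0" by (metis not_le)
      define d where "d = c * (g \<bullet> g) - g \<bullet> (S *v g)"
      define t where "t = - (g \<bullet> g) / (\<bar>d\<bar> + 1)"
      have tn: "t < 0" using gp by (simp add: t_def divide_neg_pos)
      have "0 \<le> t * (2 * (g \<bullet> g) + t * d)"
        using quad[of t] by (simp add: d_def algebra_simps power2_eq_square)
      then have "2 * (g \<bullet> g) + t * d \<le> 0" using tn by (simp add: zero_le_mult_iff)
      moreover have "\<bar>t * d\<bar> \<le> g \<bullet> g"
        using gp by (simp add: t_def abs_mult field_simps)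
      ultimately show False using gp by linarith
    qed
    then have "g = 0" by (metis inner_ge_zero inner_eq_zero_iff order_antisym)
    then have Su: "S *v u = c *\<^sub>R u" by (simp add: g_def)
    let ?W = "{x \<in> V. u \<bullet> x = 0}"
    have W: "subspace ?W"
      using less.prems(1) by (auto simp: subspace_def inner_simps)
    have "S *v x \<in> ?W" if "x \<in> ?W" for x
      using that less.prems(2) sa[of u x] by (simp add: Su)
    moreover have "dim ?W < dim V"
    proof -
      have "u \<notin> ?W" by (simp add: uu)
      then have "?W \<subset> V" using uV by blast
      then show ?thesis
        using W less.prems(1) by (intro dim_psubset) (metis span_eq_iff)
    qed
    ultimately obtain B where B: "B \<subseteq> ?W" "pairwise orthogonal B"
        "\<forall>b\<in>B. norm b = 1 \<and> (\<exists>l. S *v b = l *\<^sub>R b)" "span B = ?W"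
      using less.hyps W by meson
    have "span (insert u B) = V"
    proof
      show "span (insert u B) \<subseteq> V"
        using B(1) uV less.prems(1) by (intro span_minimal) auto
      show "V \<subseteq> span (insert u B)"
      proof
        fix x assume "x \<in> V"
        then have "x - (u \<bullet> x) *\<^sub>R u \<in> span B"
          using less.prems(1) uV
          by (simp add: B(4) subspace_diff subspace_scale inner_simps uu)
        then show "x \<in> span (insert u B)" using span_breakdown_eq by blast
      qed
    qed
    moreover have "pairwise orthogonal (insert u B)"
      using B(1,2) by (auto simp: pairwise_insert orthogonal_def inner_commute)
    ultimately show ?thesis
      using B(1,3) uV u Su by (intro exI[of _ "insert u B"]) auto
  qed
qed

lemma ex_orthonormal_eigensystem:
  fixes S :: "real^'n^'n"
  assumes "symmetric S"
  shows "\<exists>v l. orthonormal_eigensystem S v l"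
proof -
  obtain B where B: "pairwise orthogonal B"
      "\<forall>b\<in>B. norm b = 1 \<and> (\<exists>l. S *v b = l *\<^sub>R b)" "span B = UNIV"
    using symmetric_invariant_subspace_eigenbasis[OF assms, of UNIV] by auto
  have ind: "independent B"
    using B(1,2) by (intro pairwise_orthogonal_independent) auto
  have "card B = CARD('n)"
    using dim_eq_card_independent[OF ind] B(3) by (metis dim_span dim_UNIV DIM_cart DIM_real mult.right_neutral)
  moreover have "finite B" using ind by (rule independent_imp_finite)
  ultimately obtain v where v: "bij_betw v (UNIV :: 'n set) B"
    using finite_same_card_bij[of "UNIV :: 'n set" B] by auto
  have vB: "v k \<in> B" for k using v by (auto simp: bij_betw_def)
  obtain l where l: "\<forall>k. S *v v k = l k *\<^sub>R v k"
    using choice[of "\<lambda>k l. S *v v k = l *\<^sub>R v k"] B(2) vB by blast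
  have "v j \<bullet> v k = (if j = k then 1 else 0)" for j k
  proof (cases "j = k")
    case True
    then show ?thesis using B(2) vB by (simp add: norm_eq_1)
  next
    case False
    then have "v j \<noteq> v k" using v by (auto simp: bij_betw_def inj_def)
    then show ?thesis using False B(1) vB by (simp add: pairwise_def orthogonal_def)
  qed
  then show ?thesis using l unfolding orthonormal_eigensystem_def by blast
qed

text \<open>Complex eigenvalues of a real matrix; this set is finite and nonempty, so the maximum
  in \<open>spectral_radius\<close> is proper.\<close>

definition spectrum :: "real^'n^'n \<Rightarrow> complex set" where
  "spectrum M = {c. \<exists>v :: complex^'n. v \<noteq> 0 \<and> map_matrix complex_of_real M *v v = c *s v}"

definition spectral_radius :: "real^'n^'n \<Rightarrow> real" where
  "spectral_radius M = Max (cmod ` spectrum M)"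

primrec state :: "(nat \<Rightarrow> 'w \<Rightarrow> real^'n^'n) \<Rightarrow> real^'n \<Rightarrow> nat \<Rightarrow> 'w \<Rightarrow> real^'n" where
  "state F x0 0 = (\<lambda>\<omega>. x0)"
| "state F x0 (Suc t) = (\<lambda>\<omega>. F t \<omega> *v state F x0 t \<omega>)"

text \<open>Integrability is demanded explicitly because the Bochner integral of a non-integrable
  function is \<open>0\<close> by convention.\<close>

definition mean_square_stable :: "'w measure \<Rightarrow> (nat \<Rightarrow> 'w \<Rightarrow> real^'n^'n) \<Rightarrow> bool" where
  "mean_square_stable M F \<longleftrightarrow> (\<forall>x0.
     (\<forall>t. integrable M (\<lambda>\<omega>. outer (state F x0 t \<omega>) (state F x0 t \<omega>))) \<and>
     (\<lambda>t. \<integral>\<omega>. outer (state F x0 t \<omega>) (state F x0 t \<omega>) \<partial>M) \<longlonglongrightarrow> 0)"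

end

theory Submission
  imports Defs "HOL-Computational_Algebra.Fundamental_Theorem_Algebra"
begin

text \<open>
  The matrix \<open>P\<close> that certifies the stochastic system also serves as a Lyapunov matrix for every
  perturbed system \<open>N = A + (\<Sum>i. \<mu> i *\<^sub>R B i)\<close>: the form \<open>x \<bullet> (P *v x)\<close> strictly decreases along
  \<open>N\<close>. Put \<open>R = p Q + (\<Sum>i. \<alpha> i B i\<^sup>T P B i)\<close> with \<open>p\<close> the number of the \<open>B i\<close>, so that the equation for \<open>P\<close> reads
  \<open>P = A\<^sup>T P A + R\<close>. Expanding \<open>N\<^sup>T P N\<close> (\<open>quadratic_form_perturbation\<close>) gives \<open>A\<^sup>T P A\<close> plus
  terms linear and quadratic in \<open>\<mu>\<close>, so decrease means that these terms stay below \<open>R\<close>.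
  Since the \<open>\<mu> i\<close> are nonnegative, replacing each symmetric coefficient by its positive part only
  increases the terms (\<open>quadratic_form_le_pos_part\<close>), and afterwards they are monotone in \<open>\<mu>\<close>.
  There are finitely many indices, so \<open>\<mu> i \<le> \<theta> * \<eta> i\<close> for a common \<open>\<theta> < 1\<close>
  (\<open>ex_uniform_contraction\<close>); the assumed bound on the \<open>\<eta> i\<close> then limits the terms by \<open>\<theta> R\<close>, and
  \<open>\<theta> R\<close> is strictly below \<open>R\<close> because \<open>Q\<close>, and with it \<open>R\<close>, is positive definite.

  Lyapunov's criterion (\<open>spectral_radius_less_1_if_Lyapunov\<close>) turns the decrease into a bound on each
  complex eigenvalue. Passing to the maximum of their moduli requires the spectrum to be finite
  and nonempty; both properties come from one nonzero polynomial that annihilates the matrix.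
\<close>

section \<open>The complex spectrum of a real matrix is finite and nonempty\<close>

text \<open>The vector \<open>p(C) v\<close>, computed by Horner's scheme. Acting on vectors avoids evaluating a
  polynomial in the noncommutative ring of matrices, which \<open>poly\<close> cannot do.\<close>

definition poly_act :: "complex^'n^'n \<Rightarrow> complex poly \<Rightarrow> complex^'n \<Rightarrow> complex^'n" where
  "poly_act C p v = fold_coeffs (\<lambda>a w. a *s v + C *v w) p 0"

lemma poly_act_0 [simp]: "poly_act C 0 v = 0"
  by (simp add: poly_act_def)

lemma poly_act_pCons [simp]: "poly_act C (pCons a p) v = a *s v + C *v poly_act C p v"
  by (cases "p = 0 \<and> a = 0") (auto simp: poly_act_def)

lemma poly_act_add: "poly_act C (p + q) v = poly_act C p v + poly_act C q v"
  by (induction p q rule: poly_induct2)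
    (simp_all add: matrix_vector_right_distrib vector_sadd_rdistrib algebra_simps)

lemma poly_act_smult: "poly_act C (smult c p) v = c *s poly_act C p v"
  by (induction p) (simp_all add: vector_add_ldistrib vector_scalar_commute vector_smult_assoc)

lemma poly_act_sum: "poly_act C (\<Sum>k\<in>K. f k) v = (\<Sum>k\<in>K. poly_act C (f k) v)"
  by (induction K rule: infinite_finite_induct) (simp_all add: poly_act_add)

lemma poly_act_linear_factor:
  "poly_act C ([:- a, 1:] * q) v = C *v poly_act C q v - a *s poly_act C q v"
proof -
  have "[:- a, 1:] * q = pCons 0 q + smult (- a) q" by simp
  then show ?thesis
    by (simp only: poly_act_add poly_act_smult poly_act_pCons) (simp add: vec_eq_iff)
qed

lemma poly_act_eigenvector:
  assumes "C *v v = c *s v"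
  shows "poly_act C p v = poly p c *s v"
  by (induction p)
    (simp_all add: vector_scalar_commute assms vector_smult_assoc vector_sadd_rdistrib mult.commute)

lemma poly_act_monom: "poly_act C (monom a k) v = a *s (((**) C ^^ k) (mat 1) *v v)"
  by (induction k)
    (simp_all add: monom_0 monom_Suc vector_scalar_commute matrix_vector_mul_assoc[symmetric])

lemma scaleR_eq_vector_scalar_mult: "r *\<^sub>R (v :: complex^'n) = complex_of_real r *s v"
  by (simp add: vec_eq_iff scaleR_conv_of_real[where 'a = complex])

text \<open>More vectors than the dimension are dependent. Coefficients are attached to the indices rather
  than to the vectors because the sequence may repeat a vector, and a repetition is itself a
  relation.\<close>

lemma linear_relation_of_sequence:
  fixes X :: "nat \<Rightarrow> 'a::euclidean_space"
  shows "\<exists>u :: nat \<Rightarrow> real. \<exists>K. finite K \<and> (\<exists>k\<in>K. u k \<noteq> 0) \<and> (\<Sum>k\<in>K. u k *\<^sub>R X k) = 0"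
proof (cases "inj X")
  case True
  have "dependent (range X)"
    using True independent_imp_finite finite_imageD infinite_UNIV_nat by blast
  then obtain S w where S: "finite S" "S \<subseteq> range X" "(\<Sum>v\<in>S. w v *\<^sub>R v) = 0" "\<exists>v\<in>S. w v \<noteq> 0"
    unfolding dependent_explicit by blast
  define K where "K = X -` S"
  have SK: "S = X ` K" using S(2) by (auto simp: K_def)
  have "finite K" unfolding K_def using S(1) True by (rule finite_vimageI)
  moreover have "(\<Sum>k\<in>K. w (X k) *\<^sub>R X k) = 0"
    using S(3) True unfolding SK by (subst (asm) sum.reindex) (auto intro: inj_on_subset)
  ultimately show ?thesis
    using S(4) unfolding SK by (intro exI[of _ "w \<circ> X"] exI[of _ K]) auto
next
  case False
  then obtain i j where ij: "i \<noteq> j" "X i = X j" by (auto simp: inj_def)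
  then show ?thesis
    by (intro exI[of _ "\<lambda>k. if k = i then 1 else - 1"] exI[of _ "{i, j}"]) auto
qed

text \<open>The powers of \<open>C\<close> lie in a finite-dimensional space, so they satisfy a linear relation. Real
  coefficients suffice, which allows the matrices to be treated as a Euclidean space over the
  reals.\<close>

lemma ex_annihilating_poly:
  fixes C :: "complex^'n^'n"
  shows "\<exists>p. p \<noteq> 0 \<and> (\<forall>v. poly_act C p v = 0)"
proof -
  let ?X = "\<lambda>k. ((**) C ^^ k) (mat 1)"
  obtain u :: "nat \<Rightarrow> real" and K where K: "finite K" "\<exists>k\<in>K. u k \<noteq> 0" "(\<Sum>k\<in>K. u k *\<^sub>R ?X k) = 0"
    using linear_relation_of_sequence[of ?X] by blast
  define p where "p = (\<Sum>k\<in>K. monom (complex_of_real (u k)) k)"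
  have "coeff p k = (if k \<in> K then u k else 0)" for k
    using K(1) by (simp add: p_def coeff_sum)
  then have "p \<noteq> 0" using K(2) by (metis coeff_0 of_real_eq_0_iff)
  moreover have "poly_act C p v = 0" for v
  proof -
    have scaleR_matrix: "r *\<^sub>R (Y *v v) = (r *\<^sub>R Y) *v v" for r and Y :: "complex^'n^'n"
      by (simp add: vec_eq_iff matrix_vector_mult_def scaleR_sum_right)
    have "poly_act C p v = (\<Sum>k\<in>K. u k *\<^sub>R (?X k *v v))"
      by (simp add: p_def poly_act_sum poly_act_monom scaleR_eq_vector_scalar_mult)
    also have "\<dots> = (\<Sum>k\<in>K. u k *\<^sub>R ?X k) *v v"
      using K(1) by (induction K)
        (simp_all add: matrix_vector_mult_add_rdistrib scaleR_matrix)
    finally show ?thesis by (simp add: K(3))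
  qed
  ultimately show ?thesis by blast
qed

text \<open>Strip linear factors \<open>X - a\<close> off \<open>p\<close> one at a time, as the fundamental theorem of algebra
  permits. A nonzero constant does not kill \<open>v\<close>, so at some factor the remaining product \<open>q\<close> has
  \<open>q(C) v \<noteq> 0\<close> while \<open>(C - a) q(C) v = 0\<close>.\<close>

lemma ex_eigenvector_of_annihilated:
  fixes C :: "complex^'n^'n"
  assumes "p \<noteq> 0" "v \<noteq> 0" "poly_act C p v = 0"
  shows "\<exists>c w. w \<noteq> 0 \<and> C *v w = c *s w"
  using assms
proof (induction "degree p" arbitrary: p)
  case 0
  then obtain a where "p = [:a:]" "a \<noteq> 0"
    by (metis degree_eq_zeroE pCons_0_0)
  with 0 show ?case by simp
next
  case (Suc d)
  then have "\<not> constant (poly p)" by (simp add: constant_degree)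
  then obtain a where "poly p a = 0" using fundamental_theorem_of_algebra by blast
  then obtain q where q: "p = [:- a, 1:] * q" by (metis poly_eq_0_iff_dvd dvdE)
  with Suc.prems(1) have "q \<noteq> 0" by auto
  then have dq: "d = degree q"
    using Suc.hyps(2) q by (simp add: degree_mult_eq del: mult_pCons_left)
  have eig: "C *v poly_act C q v = a *s poly_act C q v"
    using Suc.prems(3) unfolding q poly_act_linear_factor by simp
  show ?case
  proof (cases "poly_act C q v = 0")
    case True
    then show ?thesis using Suc.hyps(1)[OF dq \<open>q \<noteq> 0\<close> \<open>v \<noteq> 0\<close>] by blast
  next
    case False
    then show ?thesis using eig by blast
  qed
qed

lemma spectrum_nonempty: "spectrum M \<noteq> {}"
proof -
  obtain p where p: "p \<noteq> 0" "poly_act (map_matrix complex_of_real M) p 1 = 0"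
    using ex_annihilating_poly by blast
  have "(1 :: complex^'a) \<noteq> 0" by (simp add: vec_eq_iff)
  from ex_eigenvector_of_annihilated[OF p(1) this p(2)] show ?thesis
    by (auto simp: spectrum_def)
qed

lemma finite_spectrum: "finite (spectrum M)"
proof -
  obtain p where p: "p \<noteq> 0" "\<And>v. poly_act (map_matrix complex_of_real M) p v = 0"
    using ex_annihilating_poly by blast
  have "spectrum M \<subseteq> {c. poly p c = 0}"
  proof
    fix c assume "c \<in> spectrum M"
    then obtain v where "v \<noteq> 0" "map_matrix complex_of_real M *v v = c *s v"
      by (auto simp: spectrum_def)
    then have "v \<noteq> 0" "poly p c *s v = 0" using p(2) poly_act_eigenvector by metis+
    then show "c \<in> {c. poly p c = 0}" by (simp add: vector_mul_eq_0)
  qed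
  then show ?thesis using poly_roots_finite[OF p(1)] finite_subset by blast
qed

lemma spectral_radius_less_iff: "spectral_radius M < r \<longleftrightarrow> (\<forall>c\<in>spectrum M. cmod c < r)"
  unfolding spectral_radius_def using finite_spectrum spectrum_nonempty by (subst Max_less_iff) auto

section \<open>Lyapunov's criterion\<close>

text \<open>Let \<open>v = a + \<i> b\<close> be a complex eigenvector for \<open>c\<close> and \<open>q\<close> the quadratic form of \<open>P\<close>. The form
  \<open>q a + q b\<close> is the Hermitian value of \<open>P\<close> at \<open>v\<close>, so \<open>N\<close> multiplies it by \<open>\<bar>c\<bar>\<^sup>2\<close>; since it also
  decreases, \<open>\<bar>c\<bar> < 1\<close>. Working with the real and imaginary parts keeps everything within real
  quadratic forms.\<close>

lemma spectral_radius_less_1_if_Lyapunov: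
  fixes N P :: "real^'n^'n"
  assumes pos: "\<And>x. x \<noteq> 0 \<Longrightarrow> 0 < x \<bullet> (P *v x)"
    and dec: "\<And>x. x \<noteq> 0 \<Longrightarrow> (N *v x) \<bullet> (P *v (N *v x)) < x \<bullet> (P *v x)"
  shows "spectral_radius N < 1"
  unfolding spectral_radius_less_iff
proof
  fix c assume "c \<in> spectrum N"
  then obtain v :: "complex^'n" where v: "v \<noteq> 0" "map_matrix complex_of_real N *v v = c *s v"
    by (auto simp: spectrum_def)
  define a b where "a = (\<chi> i. Re (v $ i))" and "b = (\<chi> i. Im (v $ i))"
  define r s where "r = Re c" and "s = Im c"
  define q where "q x = x \<bullet> (P *v x)" for x
  have comp: "(\<Sum>j\<in>UNIV. complex_of_real (N $ i $ j) * v $ j) = c * v $ i" for i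
    using v(2) by (simp add: vec_eq_iff matrix_vector_mult_def)
  have Na: "N *v a = r *\<^sub>R a - s *\<^sub>R b" and Nb: "N *v b = s *\<^sub>R a + r *\<^sub>R b"
    using arg_cong[OF comp, of Re] arg_cong[OF comp, of Im]
    by (simp_all add: vec_eq_iff matrix_vector_mult_def a_def b_def r_def s_def algebra_simps)
  have "q (N *v a) + q (N *v b) = (r\<^sup>2 + s\<^sup>2) * (q a + q b)"
    by (simp add: q_def Na Nb matrix_vector_right_distrib matrix_vector_mult_diff_distrib
        matrix_vector_mult_scaleR inner_simps power2_eq_square algebra_simps)
  moreover have "q (N *v a) + q (N *v b) < q a + q b" and "0 < q a + q b"
  proof -
    have ab: "a \<noteq> 0 \<or> b \<noteq> 0"
      using v(1) by (auto simp: a_def b_def vec_eq_iff complex_eq_iff)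
    have "q (N *v x) \<le> q x" "0 \<le> q x" for x
      using pos[of x] dec[of x] by (cases "x = 0"; simp add: q_def)+
    then show "q (N *v a) + q (N *v b) < q a + q b" "0 < q a + q b"
      using ab pos dec unfolding q_def
      by (metis add_less_le_mono add_le_less_mono, metis add_pos_nonneg add_nonneg_pos)
  qed
  ultimately have "r\<^sup>2 + s\<^sup>2 < 1"
    by (metis mult_less_cancel_right_pos mult_1)
  then show "cmod c < 1" by (simp add: cmod_def r_def s_def)
qed

section \<open>Quadratic forms of positive parts\<close>

lemma quadratic_form_eigensystem:
  fixes S :: "real^'n^'n"
  assumes "orthonormal_eigensystem S v l"
  shows "x \<bullet> (S *v x) = (\<Sum>k\<in>UNIV. l k * (v k \<bullet> x)\<^sup>2)"
proof -
  have "S *v x = S *v (\<Sum>k\<in>UNIV. (v k \<bullet> x) *\<^sub>R v k)"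
    using orthonormal_eigensystem_expand[OF assms, of x] by simp
  also have "\<dots> = (\<Sum>k\<in>UNIV. (v k \<bullet> x) *\<^sub>R l k *\<^sub>R v k)"
    using assms by (simp add: linear_sum[OF matrix_vector_mul_linear] matrix_vector_mult_scaleR
        orthonormal_eigensystem_def)
  finally show ?thesis
    by (simp add: inner_sum_right power2_eq_square inner_commute[of x] mult_ac)
qed

text \<open>In an orthonormal eigenbasis the form of the positive part has coefficients
  \<open>max (l k) 0\<close> where that of \<open>S\<close> has \<open>l k\<close>.\<close>

lemma quadratic_form_pos_part:
  fixes S :: "real^'n^'n"
  assumes "symmetric S"
  shows quadratic_form_pos_part_nonneg: "0 \<le> x \<bullet> (pos_part S *v x)"
    and quadratic_form_le_pos_part: "x \<bullet> (S *v x) \<le> x \<bullet> (pos_part S *v x)"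
proof -
  obtain v l where sys: "orthonormal_eigensystem S v l"
    using ex_orthonormal_eigensystem[OF assms] by blast
  have "x \<bullet> (pos_part S *v x) = (\<Sum>k | l k > 0. l k * (v k \<bullet> x)\<^sup>2)"
    unfolding pos_part_eq[OF assms sys]
    by (simp add: sum_mat_mult_vec scaleR_matrix_vector_assoc[symmetric] outer_mult_vec
        inner_sum_right power2_eq_square inner_commute[of x] mult.assoc)
  also have "\<dots> = (\<Sum>k\<in>UNIV. max (l k) 0 * (v k \<bullet> x)\<^sup>2)"
    by (rule sum.mono_neutral_cong_left) (auto simp: max_def)
  finally have pp: "x \<bullet> (pos_part S *v x) = (\<Sum>k\<in>UNIV. max (l k) 0 * (v k \<bullet> x)\<^sup>2)" .
  show "0 \<le> x \<bullet> (pos_part S *v x)"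
    unfolding pp by (intro sum_nonneg) simp
  show "x \<bullet> (S *v x) \<le> x \<bullet> (pos_part S *v x)"
    unfolding pp quadratic_form_eigensystem[OF sys]
    by (intro sum_mono mult_right_mono) auto
qed

lemma inner_congruence:
  fixes P X Y :: "real^'n^'n"
  shows "x \<bullet> ((transpose X ** P ** Y) *v x) = (X *v x) \<bullet> (P *v (Y *v x))"
  by (metis dot_lmul_matrix inner_commute matrix_vector_mul_assoc transpose_matrix_vector transpose_transpose)

lemma symmetric_congruence_sum:
  fixes P X Y :: "real^'n^'n"
  assumes "symmetric P"
  shows "symmetric (transpose X ** P ** Y + transpose Y ** P ** X)"
proof -
  have "transpose (U + V) = transpose U + transpose V" for U V :: "real^'n^'n"
    by (simp add: transpose_def vec_eq_iff)
  then show ?thesis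
    using assms
    by (simp add: symmetric_def matrix_transpose_mul matrix_mul_assoc add.commute)
qed

section \<open>The perturbed system\<close>

text \<open>The factor \<open>1/2\<close> comes from symmetrising the coefficients of \<open>\<mu> i * \<mu> j\<close>: each
  ordered pair contributes to the double sum twice, once in either order.\<close>

lemma quadratic_form_perturbation:
  fixes P A :: "real^'n^'n" and B :: "'p::finite \<Rightarrow> real^'n^'n"
  defines "N \<equiv> \<lambda>\<mu>. A + (\<Sum>i\<in>UNIV. \<mu> i *\<^sub>R B i)"
  shows "(N \<mu> *v x) \<bullet> (P *v (N \<mu> *v x)) = (A *v x) \<bullet> (P *v (A *v x))
    + (\<Sum>i\<in>UNIV. \<mu> i * (x \<bullet> ((transpose (B i) ** P ** A + transpose A ** P ** B i) *v x)))
    + (\<Sum>i\<in>UNIV. \<Sum>j\<in>UNIV. \<mu> i * \<mu> j *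
        (x \<bullet> ((transpose (B i) ** P ** B j + transpose (B j) ** P ** B i) *v x))) / 2"
proof -
  let ?b = "\<lambda>i j. \<mu> i * \<mu> j * ((B i *v x) \<bullet> (P *v (B j *v x)))"
  have N: "N \<mu> *v x = A *v x + (\<Sum>i\<in>UNIV. \<mu> i *\<^sub>R (B i *v x))"
    by (simp add: N_def matrix_vector_mult_add_rdistrib sum_mat_mult_vec scaleR_matrix_vector_assoc)
  have sw: "(\<Sum>i\<in>UNIV. \<Sum>j\<in>UNIV. ?b j i) = (\<Sum>i\<in>UNIV. \<Sum>j\<in>UNIV. ?b i j)"
    by (rule sum.swap)
  have "(\<Sum>i\<in>UNIV. \<Sum>j\<in>UNIV. \<mu> i * \<mu> j *
        (x \<bullet> ((transpose (B i) ** P ** B j + transpose (B j) ** P ** B i) *v x)))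
      = (\<Sum>i\<in>UNIV. \<Sum>j\<in>UNIV. ?b i j) + (\<Sum>i\<in>UNIV. \<Sum>j\<in>UNIV. ?b j i)"
    by (simp add: matrix_vector_mult_add_rdistrib inner_add_right inner_congruence
        distrib_left sum.distrib mult_ac)
  then have dbl: "(\<Sum>i\<in>UNIV. \<Sum>j\<in>UNIV. \<mu> i * \<mu> j *
        (x \<bullet> ((transpose (B i) ** P ** B j + transpose (B j) ** P ** B i) *v x))) / 2
      = (\<Sum>i\<in>UNIV. \<Sum>j\<in>UNIV. ?b i j)"
    using sw by simp
  show ?thesis
    unfolding N dbl sw[symmetric]
    by (simp add: matrix_vector_mult_add_rdistrib matrix_vector_right_distrib inner_congruence
        linear_sum[OF matrix_vector_mul_linear] matrix_vector_mult_scaleR inner_add_left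
        inner_add_right inner_sum_left inner_sum_right sum.distrib distrib_left sum_distrib_left mult_ac)
qed

text \<open>The largest of the finitely many ratios \<open>\<mu> i / \<eta> i\<close> is still below \<open>1\<close>.\<close>

lemma ex_uniform_contraction:
  fixes \<mu> \<eta> :: "'p::finite \<Rightarrow> real"
  assumes "\<And>i. 0 \<le> \<mu> i" "\<And>i. \<mu> i < \<eta> i"
  shows "\<exists>\<theta>\<ge>0. \<theta> < 1 \<and> (\<forall>i. \<mu> i \<le> \<theta> * \<eta> i)"
proof (intro exI conjI allI)
  let ?\<theta> = "Max (range (\<lambda>i. \<mu> i / \<eta> i))"
  have \<eta>: "\<eta> i > 0" for i using assms[of i] by linarith
  have le: "\<mu> i / \<eta> i \<le> ?\<theta>" for i by (rule Max_ge) auto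
  show "\<mu> i \<le> ?\<theta> * \<eta> i" for i using le[of i] unfolding pos_divide_le_eq[OF \<eta>] .
  show "0 \<le> ?\<theta>" using le[of undefined] assms \<eta> by (meson divide_nonneg_pos order_trans)
  show "?\<theta> < 1" using assms \<eta> by (subst Max_less_iff) auto
qed

theorem theorem3p2:
  fixes M :: "'w measure"
    and A :: "real^'n^'n"
    and B :: "'p::finite \<Rightarrow> real^'n^'n"
    and \<gamma> :: "nat \<Rightarrow> 'p \<Rightarrow> 'w \<Rightarrow> real"
    and \<alpha> \<eta> :: "'p \<Rightarrow> real"
    and P Q :: "real^'n^'n"
  assumes "prob_space M"
    and "prob_space.indep_vars M (\<lambda>_. borel) (\<lambda>(t, i). \<gamma> t i) (UNIV :: (nat \<times> 'p) set)"
    and "\<And>s t i. distr M borel (\<gamma> s i) = distr M borel (\<gamma> t i)"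
    and "\<And>t i. integrable M (\<gamma> t i)" and "\<And>t i. (\<integral>\<omega>. \<gamma> t i \<omega> \<partial>M) = 0"
    and "\<And>t i. integrable M (\<lambda>\<omega>. (\<gamma> t i \<omega>)\<^sup>2)" and "\<And>t i. (\<integral>\<omega>. (\<gamma> t i \<omega>)\<^sup>2 \<partial>M) = \<alpha> i"
    and "\<And>i. \<alpha> i > 0"
    and "mean_square_stable M (\<lambda>t \<omega>. A + (\<Sum>i\<in>UNIV. \<gamma> t i \<omega> *\<^sub>R B i))"
    and "symmetric Q" and "mat 1 \<preceq>\<^sub>L Q"
    and "pd P"
    and "P = real CARD('p) *\<^sub>R Q + transpose A ** P ** A
           + (\<Sum>i\<in>UNIV. \<alpha> i *\<^sub>R (transpose (B i) ** P ** B i))"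
    and "\<And>i. \<eta> i > 0"
    and "(\<Sum>i\<in>UNIV. \<eta> i *\<^sub>R pos_part (transpose (B i) ** P ** A + transpose A ** P ** B i))
           + (\<Sum>i\<in>UNIV. \<Sum>j\<in>UNIV. (\<eta> i * \<eta> j) *\<^sub>R
                pos_part (transpose (B i) ** P ** B j + transpose (B j) ** P ** B i))
         \<preceq>\<^sub>L real CARD('p) *\<^sub>R Q + (\<Sum>i\<in>UNIV. \<alpha> i *\<^sub>R (transpose (B i) ** P ** B i))"
  shows "\<forall>\<mu> :: 'p \<Rightarrow> real. (\<forall>i. 0 \<le> \<mu> i \<and> \<mu> i < \<eta> i) \<longrightarrow>
           spectral_radius (A + (\<Sum>i\<in>UNIV. \<mu> i *\<^sub>R B i)) < 1"
proof (intro allI impI)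
  fix \<mu> :: "'p \<Rightarrow> real" assume \<mu>: "\<forall>i. 0 \<le> \<mu> i \<and> \<mu> i < \<eta> i"
  let ?S = "\<lambda>i. transpose (B i) ** P ** A + transpose A ** P ** B i"
  let ?T = "\<lambda>i j. transpose (B i) ** P ** B j + transpose (B j) ** P ** B i"
  let ?N = "A + (\<Sum>i\<in>UNIV. \<mu> i *\<^sub>R B i)"
  define R where "R = real CARD('p) *\<^sub>R Q + (\<Sum>i\<in>UNIV. \<alpha> i *\<^sub>R (transpose (B i) ** P ** B i))"
  note Ppd = assms(12) and Peq = assms(13) and bound = assms(15)[folded R_def]
  have Ppos: "0 < x \<bullet> (P *v x)" if "x \<noteq> 0" for x
    using Ppd that by (simp add: pd_def)
  have Pnn: "0 \<le> x \<bullet> (P *v x)" for x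
    using Ppos[of x] by (cases "x = 0") auto
  have symS: "symmetric (?S i)" and symT: "symmetric (?T i j)" for i j
    using Ppd symmetric_congruence_sum by (auto simp: pd_def)
  have Rpos: "0 < x \<bullet> (R *v x)" if "x \<noteq> 0" for x
  proof -
    have "0 \<le> x \<bullet> ((Q - mat 1) *v x)"
      using assms(11) by (simp add: loewner_le_def psd_def)
    then have "x \<bullet> x \<le> x \<bullet> (Q *v x)"
      by (simp add: matrix_vector_mult_diff_rdistrib inner_diff_right)
    moreover have "0 < x \<bullet> x" using that by simp
    ultimately have "0 < x \<bullet> (Q *v x)" by linarith
    then have "0 < real CARD('p) * (x \<bullet> (Q *v x))"
      by (intro mult_pos_pos) auto
    moreover have "0 \<le> (\<Sum>i\<in>UNIV. \<alpha> i * (x \<bullet> ((transpose (B i) ** P ** B i) *v x)))"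
      using Pnn assms(8) by (intro sum_nonneg mult_nonneg_nonneg) (auto simp: inner_congruence less_imp_le)
    ultimately show ?thesis
      by (simp add: R_def matrix_vector_mult_add_rdistrib sum_mat_mult_vec inner_add_right
          inner_sum_right scaleR_matrix_vector_assoc[symmetric])
  qed
  obtain \<theta> where \<theta>: "0 \<le> \<theta>" "\<theta> < 1" "\<And>i. \<mu> i \<le> \<theta> * \<eta> i"
    using ex_uniform_contraction[of \<mu> \<eta>] \<mu> by blast
  show "spectral_radius ?N < 1"
  proof (rule spectral_radius_less_1_if_Lyapunov[where P = P])
    fix x :: "real^'n" assume x: "x \<noteq> 0"
    define s where "s i = x \<bullet> (pos_part (?S i) *v x)" for i
    define t where "t i j = x \<bullet> (pos_part (?T i j) *v x)" for i j
    have s: "0 \<le> s i" "x \<bullet> (?S i *v x) \<le> s i" for i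
      unfolding s_def using quadratic_form_pos_part[OF symS] by auto
    have t: "0 \<le> t i j" "x \<bullet> (?T i j *v x) \<le> t i j" for i j
      unfolding t_def using quadratic_form_pos_part[OF symT] by auto
    have budget: "(\<Sum>i\<in>UNIV. \<eta> i * s i) + (\<Sum>i\<in>UNIV. \<Sum>j\<in>UNIV. \<eta> i * \<eta> j * t i j) \<le> x \<bullet> (R *v x)"
      using bound unfolding loewner_le_def psd_def s_def t_def
      by (simp add: matrix_vector_mult_diff_rdistrib matrix_vector_mult_add_rdistrib
          sum_mat_mult_vec inner_simps inner_sum_right scaleR_matrix_vector_assoc[symmetric])
    have lin: "\<mu> i * (x \<bullet> (?S i *v x)) \<le> \<theta> * (\<eta> i * s i)" for i
    proof -
      have "\<mu> i * (x \<bullet> (?S i *v x)) \<le> \<mu> i * s i"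
        using \<mu> s by (intro mult_left_mono) auto
      also have "\<dots> \<le> (\<theta> * \<eta> i) * s i"
        using \<theta> s by (intro mult_right_mono) auto
      finally show ?thesis by (simp add: mult_ac)
    qed
    \<comment> \<open>Bounding both factors gives \<open>\<theta>\<^sup>2\<close>; keeping \<open>\<mu> j \<le> \<eta> j\<close> for one of them leaves a single \<open>\<theta>\<close>,
      to match the linear terms.\<close>
    have quad: "\<mu> i * \<mu> j * (x \<bullet> (?T i j *v x)) \<le> \<theta> * (\<eta> i * \<eta> j * t i j)" for i j
    proof -
      have "\<mu> i * \<mu> j * (x \<bullet> (?T i j *v x)) \<le> \<mu> i * \<mu> j * t i j"
        using \<mu> t by (intro mult_left_mono) auto
      also have "\<dots> \<le> (\<theta> * \<eta> i) * \<eta> j * t i j"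
        using \<mu> \<theta> t assms(14) by (intro mult_right_mono mult_mono) (auto simp: less_imp_le)
      finally show ?thesis by (simp add: mult_ac)
    qed
    let ?L = "\<Sum>i\<in>UNIV. \<eta> i * s i" and ?D = "\<Sum>i\<in>UNIV. \<Sum>j\<in>UNIV. \<eta> i * \<eta> j * t i j"
    have "(\<Sum>i\<in>UNIV. \<mu> i * (x \<bullet> (?S i *v x))) \<le> \<theta> * ?L"
      unfolding sum_distrib_left by (intro sum_mono lin)
    moreover have "(\<Sum>i\<in>UNIV. \<Sum>j\<in>UNIV. \<mu> i * \<mu> j * (x \<bullet> (?T i j *v x))) \<le> \<theta> * ?D"
      unfolding sum_distrib_left by (intro sum_mono quad)
    \<comment> \<open>The quadratic part of the expansion carries the factor \<open>1/2\<close>; nonnegativity lets it be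
      compared with the full double sum.\<close>
    moreover have "0 \<le> \<theta> * ?D"
      using \<theta> t assms(14) by (intro mult_nonneg_nonneg sum_nonneg) (auto simp: less_imp_le)
    moreover have "\<theta> * ?L + \<theta> * ?D \<le> \<theta> * (x \<bullet> (R *v x))"
      using mult_left_mono[OF budget \<theta>(1)] by (simp add: distrib_left)
    moreover have "\<theta> * (x \<bullet> (R *v x)) < x \<bullet> (R *v x)"
      using \<theta>(2) Rpos[OF x] by simp
    moreover have "x \<bullet> (P *v x) = (A *v x) \<bullet> (P *v (A *v x)) + x \<bullet> (R *v x)"
    proof -
      have "P = transpose A ** P ** A + R"
        using Peq by (simp add: R_def algebra_simps)
      then have "x \<bullet> (P *v x) = x \<bullet> ((transpose A ** P ** A + R) *v x)" by simp
      then show ?thesis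
        by (simp add: matrix_vector_mult_add_rdistrib inner_add_right inner_congruence)
    qed
    ultimately show "(?N *v x) \<bullet> (P *v (?N *v x)) < x \<bullet> (P *v x)"
      unfolding quadratic_form_perturbation by linarith
  qed (use Ppos in blast)
qed

end
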